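(* Let $P_n$ be the path on $n$ vertices with $n \geq 4$. Then $\chi_g^\infty(P_n)=4$.
   Context: The eternal vertex coloring game (A-game) on a finite undirected graph $G$ with color set $\{1,\ldots,k\}$: all vertices are initially uncolored. Alice and Bob strictly alternate turns, Alice moving first overall. On a turn the player chooses one vertex. If it is uncolored, the player must give it a color not currently used on any of its neighbors; if it currently has color $c$, the player must change its color to a color different from $c$ that is not currently used on any of its neighbors. The player whose turn it is picks the vertex and the new color. Play proceeds in rounds: every vertex must be chosen $t$ times before any vertex is chosen $t+1$ times, for every integer $t\ge 1$ (so each vertex is chosen exactly once per round; turns keep alternating across rounds, so if $|V(G)|$ is odd Bob moves first in even-numbered rounds). If some player chooses a vertex $v$ (still available in the current round) that cannot be legally colored, i.e. every color in the color set other than the current color of $v$ (if any) appears on a neighbor of $v$, then Bob wins. In particular Bob may deliberately choose such a vertex. Alice wins if this never happens (the game goes on forever). The eternal game chromatic number $\chi_g^\infty(G)$ is the minimum $k$ such that Alice has a winning strategy on $G$ with $k$ colors. *)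

theory Defs
  imports Main
begin

record 'a ugraph =
  verts :: "'a set"
  edges :: "'a set set"

locale finite_simple_graph =
  fixes G :: "'a ugraph"
  assumes finite_verts: "finite (verts G)"
    and edgeE: "e \<in> edges G \<Longrightarrow> \<exists>u v. e = {u, v} \<and> u \<in> verts G \<and> v \<in> verts G \<and> u \<noteq> v"

definition neighbors :: "'a ugraph \<Rightarrow> 'a \<Rightarrow> 'a set" where
  "neighbors G v = {w. {v, w} \<in> edges G}"

definition path_graph :: "nat \<Rightarrow> nat ugraph" where
  "path_graph n = \<lparr> verts = {..<n}, edges = {{i, i + 1} |i. i + 1 < n} \<rparr>"

lemma finite_simple_graph_path_graph: "finite_simple_graph (path_graph n)"
proof
  show "finite (verts (path_graph n))"
    by (simp add: path_graph_def)
next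
  fix e assume "e \<in> edges (path_graph n)"
  then obtain i where "e = {i, i + 1}" "i + 1 < n"
    by (auto simp: path_graph_def)
  moreover have "i \<in> verts (path_graph n)" "i + 1 \<in> verts (path_graph n)" "i \<noteq> i + 1"
    using \<open>i + 1 < n\<close> by (simp_all add: path_graph_def)
  ultimately show "\<exists>u v. e = {u, v} \<and> u \<in> verts (path_graph n) \<and> v \<in> verts (path_graph n) \<and> u \<noteq> v"
    by blast
qed

text \<open>
  A move is a vertex with the color it receives.  A history lists all moves of the game so far,
  over all rounds, with the most recent move at the head.  Hence \<open>map_of h v\<close> is the current color
  of \<open>v\<close>, and it is \<open>None\<close> while \<open>v\<close> is uncolored.
\<close>

type_synonym 'a move = "'a \<times> nat"
type_synonym 'a history = "'a move list"

definition alice_turn :: "'a history \<Rightarrow> bool" where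
  "alice_turn h \<longleftrightarrow> even (length h)"

definition times_chosen :: "'a history \<Rightarrow> 'a \<Rightarrow> nat" where
  "times_chosen h v = count_list (map fst h) v"

text \<open>
  The round rule: a vertex may be chosen for the \<open>(t + 1)\<close>st time only once every vertex
  has been chosen at least \<open>t\<close> times.
\<close>

definition available :: "'a ugraph \<Rightarrow> 'a history \<Rightarrow> 'a \<Rightarrow> bool" where
  "available G h v \<longleftrightarrow>
     v \<in> verts G \<and> (\<forall>w \<in> verts G. times_chosen h v \<le> times_chosen h w)"

definition legal_color :: "'a ugraph \<Rightarrow> nat \<Rightarrow> 'a history \<Rightarrow> 'a \<Rightarrow> nat \<Rightarrow> bool" where
  "legal_color G k h v c \<longleftrightarrow>
     c \<in> {1..k} \<and> map_of h v \<noteq> Some c \<and> (\<forall>w \<in> neighbors G v. map_of h w \<noteq> Some c)"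

definition uncolorable :: "'a ugraph \<Rightarrow> nat \<Rightarrow> 'a history \<Rightarrow> 'a \<Rightarrow> bool" where
  "uncolorable G k h v \<longleftrightarrow> \<not> (\<exists>c. legal_color G k h v c)"

definition legal_move :: "'a ugraph \<Rightarrow> nat \<Rightarrow> 'a history \<Rightarrow> 'a move \<Rightarrow> bool" where
  "legal_move G k h m \<longleftrightarrow> available G h (fst m) \<and> legal_color G k h (fst m) (snd m)"

text \<open>
  The histories that can arise when Alice follows the strategy \<open>\<sigma>\<close> and Bob plays arbitrarily,
  as long as no uncolorable vertex has been chosen.
\<close>

inductive consistent_history ::
    "'a ugraph \<Rightarrow> nat \<Rightarrow> ('a history \<Rightarrow> 'a move) \<Rightarrow> 'a history \<Rightarrow> bool"
  for G :: "'a ugraph" and k :: nat and \<sigma> :: "'a history \<Rightarrow> 'a move" where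
  start: "consistent_history G k \<sigma> []"
| alice: "consistent_history G k \<sigma> h \<Longrightarrow> alice_turn h \<Longrightarrow> legal_move G k h (\<sigma> h) \<Longrightarrow>
    consistent_history G k \<sigma> (\<sigma> h # h)"
| bob: "consistent_history G k \<sigma> h \<Longrightarrow> \<not> alice_turn h \<Longrightarrow> legal_move G k h m \<Longrightarrow>
    consistent_history G k \<sigma> (m # h)"

text \<open>
  Bob wins as soon as either player chooses an available uncolorable vertex.  So a strategy is
  winning for Alice iff it never makes Alice choose such a vertex (it always prescribes a legal
  move) and Bob never has such a vertex at his disposal.  For a nonempty graph some vertex is
  always available, so play then continues forever.
\<close>

definition winning_strategy :: "'a ugraph \<Rightarrow> nat \<Rightarrow> ('a history \<Rightarrow> 'a move) \<Rightarrow> bool" where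
  "winning_strategy G k \<sigma> \<longleftrightarrow>
     (\<forall>h. consistent_history G k \<sigma> h \<longrightarrow>
        (if alice_turn h then legal_move G k h (\<sigma> h)
         else \<not> (\<exists>v. available G h v \<and> uncolorable G k h v)))"

text \<open>
  The minimum is over a nonempty set for every finite nonempty simple graph: with at least
  maximum degree plus two colors no vertex is ever uncolorable.
\<close>

definition eternal_game_chromatic_number :: "'a ugraph \<Rightarrow> nat" where
  "eternal_game_chromatic_number G = (LEAST k. \<exists>\<sigma>. winning_strategy G k \<sigma>)"

end

theory Submission
  imports Defs
begin

text \<open>
  Four colors suffice because at most three are ever forbidden at a vertex of degree at most two.

  With three colors, a colored vertex \<open>v\<close> is stuck as soon as two of its neighbors carry different
  colors.  Let \<open>u, v, w\<close> be a path in which \<open>u\<close> is the vertex Alice has just chosen as the first move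
  of a round.  Bob answers at \<open>w\<close> so that the colors of \<open>u\<close> and \<open>w\<close> differ.  If the order of the
  graph is odd, he does this in the first round; at its end \<open>v\<close> is stuck and Bob moves first in the
  second round.  If the order is even, he does this in the second round, where Alice moves first: if
  \<open>v\<close> is not stuck already, then \<open>u\<close> and \<open>w\<close> have the same color, so that every recoloring of \<open>w\<close> makes
  \<open>v\<close> stuck for the rest of the round.
\<close>

section \<open>Invariants of histories: counts, colors and properness\<close>

lemma in_neighbors_commute: "u \<in> neighbors G v \<longleftrightarrow> v \<in> neighbors G u"
  by (simp add: neighbors_def insert_commute)

lemma times_chosen_Nil [simp]: "times_chosen [] v = 0"
  by (simp add: times_chosen_def)

lemma times_chosen_Cons [simp]:
  "times_chosen (m # h) v = (if fst m = v then Suc (times_chosen h v) else times_chosen h v)"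
  by (simp add: times_chosen_def)

lemma times_chosen_append [simp]:
  "times_chosen (g @ h) v = times_chosen g v + times_chosen h v"
  by (simp add: times_chosen_def)

lemma times_chosen_eq_0_iff: "times_chosen h v = 0 \<longleftrightarrow> map_of h v = None"
  by (induction h) auto

lemma colored_if_times_chosen_pos:
  assumes "times_chosen h v > 0"
  obtains c where "map_of h v = Some c"
  using assms by (metis not_None_eq not_less_iff_gr_or_eq times_chosen_eq_0_iff)

lemma consistent_history_Cons:
  assumes "winning_strategy G k \<sigma>" "consistent_history G k \<sigma> h" "alice_turn h"
  shows "legal_move G k h (\<sigma> h)" "consistent_history G k \<sigma> (\<sigma> h # h)"
  using assms unfolding winning_strategy_def by (auto intro: consistent_history.alice)

lemma legal_color_for_bob:
  assumes "winning_strategy G k \<sigma>" "consistent_history G k \<sigma> h" "\<not> alice_turn h" "available G h v"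
  obtains c where "legal_color G k h v c"
  using assms unfolding winning_strategy_def uncolorable_def by metis

text \<open>The invariants below depend only on the legality of moves, so the cases of Alice and Bob
  are merged into one.\<close>

lemma consistent_history_legal_induct [consumes 1, case_names Nil Cons]:
  assumes "consistent_history G k \<sigma> h" "P []"
    and "\<And>h v c. P h \<Longrightarrow> legal_move G k h (v, c) \<Longrightarrow> P ((v, c) # h)"
  shows "P h"
  using assms by (induction rule: consistent_history.induct) (metis surj_pair)+

lemma consistent_history_imp_colors:
  assumes "consistent_history G k \<sigma> h" "map_of h v = Some c"
  shows "c \<in> {1..k}"
  using assms
  by (induction h arbitrary: c rule: consistent_history_legal_induct)
    (auto simp: legal_move_def legal_color_def split: if_splits)

text \<open>A legal color avoids those of all neighbors, so each move preserves properness. The last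
  premise excludes two uncolored neighbors, which share the value \<open>None\<close>.\<close>

lemma consistent_history_imp_proper:
  assumes "consistent_history G k \<sigma> h" "v \<in> neighbors G u" "u \<noteq> v" "map_of h u \<noteq> None"
  shows "map_of h u \<noteq> map_of h v"
  using assms
proof (induction h arbitrary: u v rule: consistent_history_legal_induct)
  case (Cons h x c)
  then have "\<forall>w\<in>neighbors G x. map_of h w \<noteq> Some c"
    by (simp add: legal_move_def legal_color_def)
  then show ?case
    using Cons.IH[OF Cons.prems(1,2)] Cons.prems in_neighbors_commute[of u G v] by auto
qed simp

text \<open>Only a vertex with minimal count is ever chosen, so no count can run ahead of another by
  more than one.\<close>

lemma consistent_history_balanced:
  assumes "consistent_history G k \<sigma> h" "v \<in> verts G" "w \<in> verts G"
  shows "times_chosen h v \<le> Suc (times_chosen h w)"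
  using assms
proof (induction h rule: consistent_history_legal_induct)
  case (Cons h x c)
  then have "times_chosen h x \<le> times_chosen h w"
    by (simp add: legal_move_def available_def)
  with Cons show ?case
    by auto
qed simp

section \<open>Rounds and continuation of play on finite graphs\<close>

context finite_simple_graph
begin

lemma neighbor_neq: "v \<in> neighbors G u \<Longrightarrow> u \<noteq> v"
  using edgeE[of "{u, v}"] by (auto simp: neighbors_def doubleton_eq_iff)

lemma neighbor_in_verts: "v \<in> neighbors G u \<Longrightarrow> v \<in> verts G"
  using edgeE[of "{u, v}"] by (auto simp: neighbors_def doubleton_eq_iff)

lemma available_exists:
  assumes "verts G \<noteq> {}"
  obtains v where "available G h v"
  using arg_min_if_finite[OF finite_verts assms, of "times_chosen h"]
  unfolding available_def by (metis not_le)

lemma sum_times_chosen_Cons: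
  assumes "legal_move G k h m"
  shows "(\<Sum>v\<in>verts G. times_chosen (m # h) v) = Suc (\<Sum>v\<in>verts G. times_chosen h v)"
proof -
  have "fst m \<in> verts G"
    using assms by (simp add: legal_move_def available_def)
  moreover have "times_chosen (m # h) v = (if fst m = v then 1 else 0) + times_chosen h v" for v
    by simp
  ultimately show ?thesis
    by (simp only: sum.distrib) (simp add: finite_verts)
qed

lemma sum_times_chosen:
  assumes "consistent_history G k \<sigma> h"
  shows "(\<Sum>v\<in>verts G. times_chosen h v) = length h"
  using assms
  by (induction rule: consistent_history_legal_induct)
    (simp, simp only: sum_times_chosen_Cons length_Cons)

text \<open>The counts add up to \<open>t * card (verts G)\<close>. If one count exceeded
  \<open>t\<close>, balance would keep all others at least \<open>t\<close> and the sum would be too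
  large; a count below \<open>t\<close> fails symmetrically.\<close>

lemma times_chosen_end_of_round:
  assumes h: "consistent_history G k \<sigma> h" and len: "length h = t * card (verts G)"
    and v: "v \<in> verts G"
  shows "times_chosen h v = t"
proof -
  have sum: "(\<Sum>w\<in>verts G. times_chosen h w) = (\<Sum>w\<in>verts G. t)"
    using sum_times_chosen[OF h] len by simp
  have "times_chosen h v \<le> t"
  proof (rule ccontr)
    assume "\<not> times_chosen h v \<le> t"
    then have "(\<Sum>w\<in>verts G. t) < (\<Sum>w\<in>verts G. times_chosen h w)"
      using consistent_history_balanced[OF h v] v finite_verts
      by (intro sum_strict_mono_ex1) (force simp: not_le)+
    with sum show False by simp
  qed
  moreover have "t \<le> times_chosen h v"
  proof (rule ccontr)
    assume "\<not> t \<le> times_chosen h v"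
    then have "(\<Sum>w\<in>verts G. times_chosen h w) < (\<Sum>w\<in>verts G. t)"
      using consistent_history_balanced[OF h _ v] v finite_verts
      by (intro sum_strict_mono_ex1) (force simp: not_le)+
    with sum show False by simp
  qed
  ultimately show ?thesis by simp
qed

text \<open>Used to play a round to its end: against a winning strategy Bob can always answer with
  some legal move, and which one is irrelevant.\<close>

lemma consistent_history_extend:
  assumes win: "winning_strategy G k \<sigma>" and ne: "verts G \<noteq> {}"
    and h: "consistent_history G k \<sigma> h"
  obtains g where "consistent_history G k \<sigma> (g @ h)" "length g = d"
proof -
  have "\<exists>g. consistent_history G k \<sigma> (g @ h) \<and> length g = d"
  proof (induction d)
    case (Suc d)
    then obtain g where g: "consistent_history G k \<sigma> (g @ h)" "length g = d"
      by blast
    have "\<exists>m. consistent_history G k \<sigma> (m # g @ h)"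
    proof (cases "alice_turn (g @ h)")
      case True
      then show ?thesis
        using consistent_history_Cons[OF win g(1)] by blast
    next
      case False
      obtain v where v: "available G (g @ h) v"
        using available_exists[OF ne] .
      then obtain c where "legal_color G k (g @ h) v c"
        using legal_color_for_bob[OF win g(1) False] by blast
      then show ?thesis
        using v consistent_history.bob[OF g(1) False, of "(v, c)"] by (auto simp: legal_move_def)
    qed
    then obtain m where "consistent_history G k \<sigma> ((m # g) @ h)"
      by auto
    then show ?case
      using g(2) by (metis length_Cons)
  qed (use h in auto)
  then show thesis
    using that by blast
qed

section \<open>Bob wins with at most three colors\<close>

text \<open>By properness \<open>b\<close> differs from \<open>a\<close> and \<open>c\<close>, so
  these are three distinct colors and \<open>d\<close> would be a fourth.\<close>

lemma uncolorable_if_neighbors_differ: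
  assumes h: "consistent_history G k \<sigma> h" and "k \<le> 3"
    and nb: "v \<in> neighbors G u" "v \<in> neighbors G w"
    and colored: "map_of h u = Some a" "map_of h v = Some b" "map_of h w = Some c" and "a \<noteq> c"
  shows "\<not> legal_color G k h v d"
proof
  assume d: "legal_color G k h v d"
  have "a \<noteq> b" "c \<noteq> b"
    using consistent_history_imp_proper[OF h nb(1)] consistent_history_imp_proper[OF h nb(2)]
      neighbor_neq[OF nb(1)] neighbor_neq[OF nb(2)] colored by auto
  moreover have "d \<noteq> a" "d \<noteq> b" "d \<noteq> c"
    using d colored nb by (auto simp: legal_color_def in_neighbors_commute[of v])
  ultimately have "card {a, b, c, d} = 4"
    using \<open>a \<noteq> c\<close> by auto
  moreover have "{a, b, c, d} \<subseteq> {1..k}"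
    using d consistent_history_imp_colors[OF h] colored unfolding legal_color_def by blast
  then have "card {a, b, c, d} \<le> card {1..k}"
    by (intro card_mono) auto
  ultimately show False
    using \<open>k \<le> 3\<close> by simp
qed

text \<open>Alice chooses \<open>u\<close>, so Bob needs a path on three vertices starting at every
  vertex.\<close>

lemma no_winning_strategy_odd:
  assumes "k \<le> 3" and ne: "verts G \<noteq> {}" and odd: "odd (card (verts G))"
    and path: "\<And>u. u \<in> verts G \<Longrightarrow> \<exists>v w. v \<in> neighbors G u \<and> w \<in> neighbors G v \<and> w \<noteq> u"
  shows "\<not> winning_strategy G k \<sigma>"
proof
  assume win: "winning_strategy G k \<sigma>"
  note start = consistent_history_Cons[OF win consistent_history.start]
  obtain u a where ua: "\<sigma> [] = (u, a)"
    by force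
  have h1: "consistent_history G k \<sigma> [(u, a)]" "u \<in> verts G"
    using start by (simp_all add: ua alice_turn_def legal_move_def available_def)
  obtain v w where v: "v \<in> neighbors G u" and w: "w \<in> neighbors G v" "w \<noteq> u"
    using path[OF h1(2)] by blast
  have v': "v \<in> neighbors G w"
    using w(1) in_neighbors_commute by metis
  have uv: "u \<noteq> v" "v \<noteq> w"
    using neighbor_neq v w by blast+
  have verts: "v \<in> verts G" "w \<in> verts G"
    using neighbor_in_verts v w by blast+
  have bob: "\<not> alice_turn [(u, a)]"
    by (simp add: alice_turn_def)
  \<comment> \<open>The color \<open>c\<close> is needed at \<open>w\<close>; that \<open>v\<close> must be colorable only serves to get a color
    other than \<open>a\<close> even when \<open>k < 3\<close>.\<close>
  obtain c where "legal_color G k [(u, a)] v c"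
    using legal_color_for_bob[OF win h1(1) bob, of v] uv verts by (auto simp: available_def)
  then have c: "c \<in> {1..k}" "a \<noteq> c"
    using v by (auto simp: legal_color_def in_neighbors_commute[of v])
  \<comment> \<open>Only \<open>u\<close> is colored so far, and not with \<open>c\<close>, so the
    move is legal even if \<open>u\<close> and \<open>w\<close> are adjacent.\<close>
  have "legal_move G k [(u, a)] (w, c)"
    using c w verts by (auto simp: legal_move_def available_def legal_color_def)
  then have h2: "consistent_history G k \<sigma> [(w, c), (u, a)]"
    using consistent_history.bob[OF h1(1) bob] by blast
  have "2 \<le> card (verts G)"
    using card_mono[OF finite_verts, of "{u, w}"] h1(2) verts w(2) by simp
  moreover obtain g where h: "consistent_history G k \<sigma> (g @ [(w, c), (u, a)])"
      and "length g = card (verts G) - 2"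
    using consistent_history_extend[OF win ne h2] .
  ultimately have g: "length (g @ [(w, c), (u, a)]) = 1 * card (verts G)"
    by simp
  note times = times_chosen_end_of_round[OF h g]
  \<comment> \<open>Both vertices have had their turn in the first round, so the rest
    \<open>g\<close> of the round cannot recolor them.\<close>
  have "times_chosen g u = 0" "times_chosen g w = 0"
    using times[OF h1(2)] times[OF verts(2)] w(2) by (auto split: if_splits)
  then have colors: "map_of (g @ [(w, c), (u, a)]) u = Some a"
      "map_of (g @ [(w, c), (u, a)]) w = Some c"
    using w(2) by (auto simp: map_add_def times_chosen_eq_0_iff)
  obtain b where b: "map_of (g @ [(w, c), (u, a)]) v = Some b"
    using colored_if_times_chosen_pos times[OF verts(1)] by (metis zero_less_one)
  have turn: "\<not> alice_turn (g @ [(w, c), (u, a)])"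
    using odd g by (simp add: alice_turn_def)
  have "available G (g @ [(w, c), (u, a)]) v"
    using times verts(1) unfolding available_def by simp
  then obtain d where "legal_color G k (g @ [(w, c), (u, a)]) v d"
    using legal_color_for_bob[OF win h turn] by blast
  then show False
    using uncolorable_if_neighbors_differ[OF h \<open>k \<le> 3\<close> v v' colors(1) b colors(2) c(2)] by blast
qed

lemma no_winning_strategy_even:
  assumes "k \<le> 3" and ne: "verts G \<noteq> {}" and even: "even (card (verts G))"
    and path: "\<And>u. u \<in> verts G \<Longrightarrow> \<exists>v w. v \<in> neighbors G u \<and> w \<in> neighbors G v \<and> w \<noteq> u"
  shows "\<not> winning_strategy G k \<sigma>"
proof
  assume win: "winning_strategy G k \<sigma>"
  \<comment> \<open>The factor 1 is the number \<open>t\<close> of completed rounds: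
    \<open>h\<close> ends the first round and every vertex is colored.\<close>
  obtain h where "consistent_history G k \<sigma> (h @ [])" "length h = 1 * card (verts G)"
    using consistent_history_extend[OF win ne consistent_history.start] .
  then have h: "consistent_history G k \<sigma> h" and len: "length h = 1 * card (verts G)"
    by simp_all
  note times = times_chosen_end_of_round[OF h len]
  have turn: "alice_turn h"
    using even len by (simp add: alice_turn_def)
  obtain u a where ua: "\<sigma> h = (u, a)"
    by force
  define h1 where "h1 = (u, a) # h"
  have h1: "consistent_history G k \<sigma> h1" and u: "u \<in> verts G"
    using consistent_history_Cons[OF win h turn]
    by (simp_all add: ua h1_def legal_move_def available_def)
  have turn1: "\<not> alice_turn h1"
    using turn by (simp add: alice_turn_def h1_def)
  obtain v w where v: "v \<in> neighbors G u" and w: "w \<in> neighbors G v" "w \<noteq> u"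
    using path[OF u] by blast
  have v': "v \<in> neighbors G w"
    using w(1) in_neighbors_commute by metis
  have uv: "u \<noteq> v" "v \<noteq> w"
    using neighbor_neq v w by blast+
  have verts: "v \<in> verts G" "w \<in> verts G"
    using neighbor_in_verts v w by blast+
  obtain b c where bc: "map_of h v = Some b" "map_of h w = Some c"
    using colored_if_times_chosen_pos times verts by (metis zero_less_one)
  have colors1: "map_of h1 u = Some a" "map_of h1 v = Some b" "map_of h1 w = Some c"
    using bc uv w(2) by (auto simp: h1_def)
  have avail1: "available G h1 v" "available G h1 w"
    using times verts uv w(2) by (auto simp: available_def h1_def)
  \<comment> \<open>Otherwise \<open>v\<close> is stuck already and Bob chooses it at once.\<close>
  have "a = c"
    using legal_color_for_bob[OF win h1 turn1 avail1(1)]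
      uncolorable_if_neighbors_differ[OF h1 \<open>k \<le> 3\<close> v v' colors1] by metis
  obtain d where d: "legal_color G k h1 w d"
    using legal_color_for_bob[OF win h1 turn1 avail1(2)] .
  \<comment> \<open>A recoloring must leave the current color of \<open>w\<close>, which equals
    \<open>a\<close>.\<close>
  then have "a \<noteq> d"
    using colors1 \<open>a = c\<close> by (auto simp: legal_color_def)
  define h2 where "h2 = (w, d) # h1"
  have h2: "consistent_history G k \<sigma> h2"
    using consistent_history.bob[OF h1 turn1, of "(w, d)"] d avail1(2)
    by (simp add: h2_def legal_move_def)
  have turn2: "alice_turn h2"
    using turn1 by (simp add: alice_turn_def h2_def)
  have colors2: "map_of h2 u = Some a" "map_of h2 v = Some b" "map_of h2 w = Some d"
    using colors1 uv w(2) by (auto simp: h2_def)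
  obtain x e where xe: "\<sigma> h2 = (x, e)"
    by force
  define h3 where "h3 = (x, e) # h2"
  have legal: "legal_move G k h2 (x, e)" and h3: "consistent_history G k \<sigma> h3"
    using consistent_history_Cons[OF win h2 turn2] by (simp_all add: xe h3_def)
  have turn3: "\<not> alice_turn h3"
    using turn2 by (simp add: alice_turn_def h3_def)
  have times2: "times_chosen h2 v = 1" "times_chosen h2 u = 2" "times_chosen h2 w = 2"
    using times u verts uv w(2) by (auto simp: h1_def h2_def)
  \<comment> \<open>Alice's reply cannot rescue \<open>v\<close>: it is stuck itself, and
    \<open>u\<close> and \<open>w\<close> are closed for this round while \<open>v\<close> has been
    chosen only once.\<close>
  have "x \<noteq> v"
    using legal uncolorable_if_neighbors_differ[OF h2 \<open>k \<le> 3\<close> v v' colors2 \<open>a \<noteq> d\<close>]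
    by (auto simp: legal_move_def)
  moreover have "x \<noteq> u" "x \<noteq> w"
    using legal verts(1) times2 by (auto simp: legal_move_def available_def dest!: bspec[where x = v])
  ultimately have colors3: "map_of h3 u = Some a" "map_of h3 v = Some b" "map_of h3 w = Some d"
    using colors2 by (auto simp: h3_def)
  have "available G h3 v"
    using times verts(1) times2(1) \<open>x \<noteq> v\<close> by (auto simp: available_def h3_def h2_def h1_def)
  then show False
    using legal_color_for_bob[OF win h3 turn3]
      uncolorable_if_neighbors_differ[OF h3 \<open>k \<le> 3\<close> v v' colors3 \<open>a \<noteq> d\<close>] by metis
qed

section \<open>Alice wins with maximum degree plus two colors\<close>

lemma finite_neighbors: "finite (neighbors G v)"
  using neighbor_in_verts finite_verts by (metis finite_subset subsetI)

lemma legal_color_exists: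
  assumes "card (neighbors G v) + 2 \<le> k"
  obtains c where "legal_color G k h v c"
proof -
  \<comment> \<open>The forbidden colors. An uncolored vertex contributes the unspecified value
    \<open>the None\<close>, which is harmless since only the size of the image is bounded.\<close>
  define F where "F = (the \<circ> map_of h) ` insert v (neighbors G v)"
  have "card F \<le> card (insert v (neighbors G v))"
    unfolding F_def by (intro card_image_le) (simp add: finite_neighbors)
  also have "\<dots> < card {1..k}"
    using assms card_insert_le_m1[of "card (neighbors G v) + 1" "neighbors G v" v] by simp
  finally have "\<not> {1..k} \<subseteq> F"
    using card_mono[of F "{1..k}"] by (auto simp: F_def finite_neighbors)
  then obtain c where "c \<in> {1..k}" "c \<notin> F"
    by blast
  then have "legal_color G k h v c"
    by (force simp: legal_color_def F_def)
  then show thesis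
    by (rule that)
qed

lemma winning_strategy_exists:
  assumes ne: "verts G \<noteq> {}" and deg: "\<And>v. v \<in> verts G \<Longrightarrow> card (neighbors G v) + 2 \<le> k"
  shows "\<exists>\<sigma>. winning_strategy G k \<sigma>"
proof
  have "\<exists>m. legal_move G k h m" for h
  proof -
    obtain v where v: "available G h v"
      using available_exists[OF ne] .
    moreover obtain c where "legal_color G k h v c"
      using legal_color_exists[OF deg] v unfolding available_def by blast
    ultimately show ?thesis
      by (auto simp: legal_move_def)
  qed
  then have "legal_move G k h (SOME m. legal_move G k h m)" for h
    by (rule someI_ex)
  moreover have "\<not> uncolorable G k h v" if "available G h v" for h v
    using that legal_color_exists[OF deg] unfolding available_def uncolorable_def by blast
  ultimately show "winning_strategy G k (\<lambda>h. SOME m. legal_move G k h m)"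
    unfolding winning_strategy_def by auto
qed

end

section \<open>Paths\<close>

lemma neighbors_path_graph:
  "w \<in> neighbors (path_graph n) v \<longleftrightarrow> v < n \<and> w < n \<and> (w = Suc v \<or> v = Suc w)"
  by (auto simp: neighbors_def path_graph_def doubleton_eq_iff)

lemma card_neighbors_path_graph: "card (neighbors (path_graph n) v) \<le> 2"
proof -
  \<comment> \<open>At \<open>v = 0\<close> the truncated \<open>v - 1\<close> is 0, which only
    enlarges the bounding set.\<close>
  have "neighbors (path_graph n) v \<subseteq> {Suc v, v - 1}"
    by (auto simp: neighbors_path_graph)
  then have "card (neighbors (path_graph n) v) \<le> card {Suc v, v - 1}"
    by (intro card_mono) auto
  then show ?thesis
    by (simp add: card_insert_if split: if_splits)
qed

lemma path_graph_two_path: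
  assumes "n \<ge> 4" "u < n"
  shows "\<exists>v w. v \<in> neighbors (path_graph n) u \<and> w \<in> neighbors (path_graph n) v \<and> w \<noteq> u"
proof (cases "u + 2 < n")
  case True
  then show ?thesis
    by (intro exI[of _ "u + 1"] exI[of _ "u + 2"]) (simp add: neighbors_path_graph)
next
  case False
  \<comment> \<open>Here \<open>u\<close> is at least 2 because \<open>n\<close> is at least 4, so
    the path can run to the left without truncation.\<close>
  with assms show ?thesis
    by (intro exI[of _ "u - 1"] exI[of _ "u - 2"]) (auto simp: neighbors_path_graph)
qed

theorem proposition3p2:
  fixes n :: nat
  assumes "n \<ge> 4"
  shows "eternal_game_chromatic_number (path_graph n) = 4"
  unfolding eternal_game_chromatic_number_def
proof (rule Least_equality)
  interpret finite_simple_graph "path_graph n"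
    by (rule finite_simple_graph_path_graph)
  have verts: "verts (path_graph n) = {..<n}"
    by (simp add: path_graph_def)
  have ne: "verts (path_graph n) \<noteq> {}"
    using assms by (simp add: verts lessThan_empty_iff)
  show "\<exists>\<sigma>. winning_strategy (path_graph n) 4 \<sigma>"
    by (rule winning_strategy_exists[OF ne]) (simp add: card_neighbors_path_graph)
  show "4 \<le> k" if "\<exists>\<sigma>. winning_strategy (path_graph n) k \<sigma>" for k
  proof (rule ccontr)
    assume "\<not> 4 \<le> k"
    then have "k \<le> 3"
      by simp
    moreover have "\<exists>v w. v \<in> neighbors (path_graph n) u \<and> w \<in> neighbors (path_graph n) v \<and> w \<noteq> u"
      if "u \<in> verts (path_graph n)" for u
      using path_graph_two_path[OF assms] that verts by simp
    ultimately show False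
      using that no_winning_strategy_odd[OF _ ne] no_winning_strategy_even[OF _ ne] by blast
  qed
qed

end
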